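(* For each Polish space $X$, the space $C_k(X)$ has the strong Pytkeev property.
   Context: For a topological space $X$, $C_k(X)$ is the set of all continuous real-valued functions on $X$ endowed with the compact-open topology. A topological space $Y$ has the strong Pytkeev property if for each $y\in Y$ there is a countable family $\mathcal{N}$ of subsets of $Y$ such that for each neighborhood $U$ of $y$ and each $A\subseteq Y$ with $y\in\overline{A}\setminus A$, there is $N\in\mathcal{N}$ such that $N\subseteq U$ and $N\cap A$ is infinite. *)

theory Defs
  imports "HOL-Analysis.Analysis"
begin

definition polish_topology :: "'a topology \<Rightarrow> bool" where
  "polish_topology X \<longleftrightarrow> completely_metrizable_space X \<and> separable_space X"

(* Only the values on topspace X matter, so each continuous function on X is represented by
   its unique representative that is extensional on topspace X. *)
definition continuous_functions :: "'a topology \<Rightarrow> ('a \<Rightarrow> real) set" where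
  "continuous_functions X =
     {f. continuous_map X euclideanreal f \<and> f \<in> extensional (topspace X)}"

definition C_k :: "'a topology \<Rightarrow> ('a \<Rightarrow> real) topology" where
  "C_k X = topology_generated_by
     {{f \<in> continuous_functions X. f ` K \<subseteq> U} |K U. compactin X K \<and> open U}"

lemma topspace_C_k [simp]: "topspace (C_k X) = continuous_functions X"
proof -
  have "continuous_functions X = {f \<in> continuous_functions X. f ` {} \<subseteq> UNIV}"
    by simp
  moreover have "compactin X {}" "open (UNIV :: real set)"
    by simp_all
  ultimately have "continuous_functions X \<in>
      {{f \<in> continuous_functions X. f ` K \<subseteq> U} |K U. compactin X K \<and> open U}"
    by blast
  then show ?thesis
    unfolding C_k_def topology_generated_by_topspace by blast
qed

definition neighbourhood_in :: "'a topology \<Rightarrow> 'a \<Rightarrow> 'a set \<Rightarrow> bool" where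
  "neighbourhood_in Y y U \<longleftrightarrow> U \<subseteq> topspace Y \<and> (\<exists>V. openin Y V \<and> y \<in> V \<and> V \<subseteq> U)"

definition strong_Pytkeev :: "'a topology \<Rightarrow> bool" where
  "strong_Pytkeev Y \<longleftrightarrow>
     (\<forall>y \<in> topspace Y. \<exists>\<N>. countable \<N> \<and> \<N> \<subseteq> Pow (topspace Y) \<and>
        (\<forall>U A. neighbourhood_in Y y U \<and> A \<subseteq> topspace Y \<and> y \<in> (Y closure_of A) - A \<longrightarrow>
           (\<exists>N \<in> \<N>. N \<subseteq> U \<and> infinite (N \<inter> A))))"

end

theory Submission
  imports Defs
begin

text \<open>
  Let \<open>y\<close> be a continuous function, \<open>K\<close> compact and \<open>q > 0\<close>. In a second countable space \<open>K\<close> has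
  a decreasing neighbourhood base \<open>B\<^sub>0 \<supseteq> B\<^sub>1 \<supseteq> \<dots>\<close> taken from a fixed countable family. Suppose that
  for each \<open>n\<close> only finitely many \<open>f \<in> A\<close> satisfy \<open>\<bar>f - y\<bar> \<le> q\<close> on \<open>B\<^sub>n\<close>. Every \<open>f \<in> A\<close> which is
  \<open>q\<close>-close to \<open>y\<close> on \<open>K\<close> has a least \<open>n\<close> such that it is \<open>q\<close>-close to \<open>y\<close> on \<open>B\<^sub>n\<close>; if \<open>n > 0\<close>, it
  fails to be so at some point \<open>x\<^sub>f \<in> B\<^bsub>n-1\<^esub>\<close>. As each \<open>n\<close> occurs finitely often, the points \<open>x\<^sub>f\<close>
  accumulate only at \<open>K\<close>, so \<open>K\<close> together with them is compact, and this compact set (enlarged by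
  finitely many points that separate \<open>y\<close> from the \<open>f\<close> with \<open>n = 0\<close>) shows that \<open>y\<close> is not in the
  closure of \<open>A\<close> if \<open>y \<notin> A\<close>.
\<close>

section \<open>Separable metrizable spaces\<close>

text \<open>The balls of radius \<open>1 / real (Suc n)\<close> around the points of a countable
  dense set form a countable base.\<close>

lemma metrizable_separable_imp_second_countable:
  assumes "metrizable_space X" "separable_space X"
  shows "second_countable X"
proof -
  obtain M d where "Metric_space M d" and X: "X = Metric_space.mtopology M d"
    using assms(1) metrizable_space_def by blast
  interpret Metric_space M d by fact
  obtain D where D: "countable D" "D \<subseteq> M" "mtopology closure_of D = M"
    using assms(2) by (auto simp: X separable_space_def)
  let ?B = "(\<lambda>(a, n). mball a (1 / real (Suc n))) ` (D \<times> UNIV)"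
  have "\<exists>V\<in>?B. x \<in> V \<and> V \<subseteq> U" if U: "openin X U" "x \<in> U" for U x
  proof -
    obtain r where r: "r > 0" "mball x r \<subseteq> U" "x \<in> M"
      using U openin_mtopology unfolding X by blast
    obtain n where n: "1 / real (Suc n) < r / 2"
      using r nat_approx_posE[of "r / 2"] by auto
    have "x \<in> mtopology closure_of D"
      using D r by simp
    then obtain a where a: "a \<in> D" "a \<in> mball x (1 / real (Suc n))"
      using r(3) unfolding metric_closure_of by (force dest: spec[of _ "1 / real (Suc n)"])
    have "mball a (1 / real (Suc n)) \<subseteq> mball x r"
      using a(2) n by (intro mball_subset) (auto simp: commute)
    moreover have "x \<in> mball a (1 / real (Suc n))"
      using a D r by (auto simp: commute)
    ultimately show ?thesis
      using a r by (intro bexI[of _ "mball a (1 / real (Suc n))"]) auto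
  qed
  moreover have "countable ?B"
    using D by simp
  moreover have "\<forall>V\<in>?B. openin X V"
    by (auto simp: X)
  ultimately show ?thesis
    unfolding second_countable_def by blast
qed

text \<open>Finite unions of members of a countable base suffice: the basic sets contained in
  \<open>U\<close> cover \<open>K\<close>, and compactness leaves finitely many of them.\<close>

lemma second_countable_compact_base:
  assumes "second_countable X"
  obtains \<G> where "countable \<G>" "\<And>V. V \<in> \<G> \<Longrightarrow> openin X V"
    "\<And>K U. compactin X K \<Longrightarrow> openin X U \<Longrightarrow> K \<subseteq> U \<Longrightarrow> \<exists>V\<in>\<G>. K \<subseteq> V \<and> V \<subseteq> U"
proof -
  obtain \<B> where \<B>: "countable \<B>" "\<And>V. V \<in> \<B> \<Longrightarrow> openin X V"
    "\<And>U x. openin X U \<Longrightarrow> x \<in> U \<Longrightarrow> \<exists>V\<in>\<B>. x \<in> V \<and> V \<subseteq> U"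
    using assms unfolding second_countable_def by metis
  let ?G = "Union ` {\<F>. finite \<F> \<and> \<F> \<subseteq> \<B>}"
  show thesis
  proof
    show "countable ?G"
      using \<B> by (intro countable_image countable_Collect_finite_subset)
    show "openin X V" if "V \<in> ?G" for V
      using that \<B>(2) by blast
    show "\<exists>V\<in>?G. K \<subseteq> V \<and> V \<subseteq> U" if K: "compactin X K" and U: "openin X U" "K \<subseteq> U" for K U
    proof -
      let ?C = "{V \<in> \<B>. V \<subseteq> U}"
      have "K \<subseteq> \<Union>?C"
        using \<B>(3)[OF U(1)] U(2) by blast
      moreover have "Ball ?C (openin X)"
        using \<B>(2) by blast
      ultimately obtain \<F> where "finite \<F>" "\<F> \<subseteq> ?C" "K \<subseteq> \<Union>\<F>"
        using compactinD[OF K, of ?C] by blast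
      then show ?thesis
        by (intro bexI[of _ "\<Union>\<F>"]) auto
    qed
  qed
qed

text \<open>A finite subcover of \<open>K\<close> has an open union, so it misses \<open>x s\<close>
  for only finitely many indices \<open>s\<close>; each of these costs one more member of the
  cover.\<close>

lemma compactin_Un_image_convergent:
  assumes K: "compactin X K" and x: "x ` S \<subseteq> topspace X"
    and conv: "\<And>W. openin X W \<Longrightarrow> K \<subseteq> W \<Longrightarrow> finite {s \<in> S. x s \<notin> W}"
  shows "compactin X (K \<union> x ` S)"
  unfolding compactin_def
proof (intro conjI allI impI)
  show "K \<union> x ` S \<subseteq> topspace X"
    using K x compactin_subset_topspace by blast
  fix \<U> assume \<U>: "Ball \<U> (openin X) \<and> K \<union> x ` S \<subseteq> \<Union>\<U>"
  then obtain \<F> where \<F>: "finite \<F>" "\<F> \<subseteq> \<U>" "K \<subseteq> \<Union>\<F>"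
    using K unfolding compactin_def by (meson le_sup_iff)
  let ?R = "{s \<in> S. x s \<notin> \<Union>\<F>}"
  have "finite ?R"
    using conv[of "\<Union>\<F>"] \<F> \<U> by blast
  moreover have "\<forall>s\<in>?R. \<exists>U\<in>\<U>. x s \<in> U"
    using \<U> by blast
  then obtain u where "\<forall>s\<in>?R. u s \<in> \<U> \<and> x s \<in> u s"
    unfolding bex_simps Bex_def by (rule bchoice[THEN exE])
  ultimately show "\<exists>\<F>. finite \<F> \<and> \<F> \<subseteq> \<U> \<and> K \<union> x ` S \<subseteq> \<Union>\<F>"
    using \<F> by (intro exI[of _ "\<F> \<union> u ` ?R"] conjI) auto
qed

section \<open>Neighbourhoods in the compact-open topology\<close>

text \<open>For compact \<open>K\<close> and \<open>e > 0\<close> these sets form a neighbourhood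
  base at a continuous \<open>y\<close>, as the next two lemmas show: the compact-open topology is
  that of uniform convergence on compact sets.\<close>

definition uniform_ball :: "'a topology \<Rightarrow> ('a \<Rightarrow> real) \<Rightarrow> 'a set \<Rightarrow> real \<Rightarrow> ('a \<Rightarrow> real) set" where
  "uniform_ball X y K e = {f \<in> continuous_functions X. \<forall>x\<in>K. \<bar>f x - y x\<bar> < e}"

lemma uniform_ball_subset_open_C_k:
  assumes "openin (C_k X) V" "y \<in> V"
  shows "\<exists>K e. compactin X K \<and> e > 0 \<and> uniform_ball X y K e \<subseteq> V"
proof -
  have "generate_topology_on
      {{f \<in> continuous_functions X. f ` K \<subseteq> U} |K U. compactin X K \<and> open U} V"
    using assms(1) unfolding C_k_def by (rule openin_topology_generated_by)
  then show ?thesis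
    using assms(2)
  proof induction
    case Empty
    then show ?case by simp
  next
    case (Int a b)
    then obtain K e L d where "compactin X K" "e > 0" "uniform_ball X y K e \<subseteq> a"
      "compactin X L" "d > 0" "uniform_ball X y L d \<subseteq> b"
      by auto
    then show ?case
      by (intro exI[of _ "K \<union> L"] exI[of _ "min e d"])
        (auto simp: compactin_Un uniform_ball_def)
  next
    case (UN \<K>)
    then show ?case by (meson Union_iff Union_upper subset_trans)
  next
    case (Basis s)
    then obtain K U where s: "s = {f \<in> continuous_functions X. f ` K \<subseteq> U}" "compactin X K" "open U"
      by auto
    have "continuous_map X euclideanreal y"
      using Basis s by (simp add: continuous_functions_def)
    then have "compact (y ` K)"
      using image_compactin s by fastforce
    then obtain e where "e > 0" "(\<Union>t\<in>y ` K. ball t e) \<subseteq> U"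
      using compact_subset_open_imp_ball_epsilon_subset[of "y ` K" U] s Basis by auto
    then have "uniform_ball X y K e \<subseteq> s"
      by (force simp: uniform_ball_def s dist_real_def abs_minus_commute)
    then show ?case
      using s \<open>e > 0\<close> by blast
  qed
qed

text \<open>Subbasic sets only constrain images of compact sets, so \<open>K\<close> is cut into
  finitely many compact pieces on which \<open>y\<close> stays close to a constant.\<close>

lemma open_C_k_subset_uniform_ball:
  assumes y: "y \<in> continuous_functions X" and K: "compactin X K" and "e > 0"
  shows "\<exists>V. openin (C_k X) V \<and> y \<in> V \<and> V \<subseteq> uniform_ball X y K e"
proof -
  have cont: "continuous_map X euclideanreal y"
    using y by (simp add: continuous_functions_def)
  then have "compact (y ` K)"
    using image_compactin K by fastforce
  moreover have "y ` K \<subseteq> (\<Union>t\<in>y ` K. ball t (e / 3))"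
    using \<open>e > 0\<close> by force
  ultimately obtain T where T: "finite T" "T \<subseteq> y ` K" "y ` K \<subseteq> (\<Union>t\<in>T. ball t (e / 3))"
    by (metis compactE_image open_ball)
  define L where "L t = {x \<in> topspace X. y x \<in> cball t (e / 3)} \<inter> K" for t
  have L: "compactin X (L t)" for t
    unfolding L_def
    by (intro closed_Int_compactin K closedin_continuous_map_preimage[OF cont]) simp
  \<comment> \<open>The radius exceeds \<open>e / 3\<close>, which puts \<open>y\<close> into
    \<open>W t\<close>; and each point of \<open>K\<close> has some \<open>t\<close> in
    \<open>T\<close> with \<open>y x\<close> closer than \<open>e / 3\<close> to \<open>t\<close>,
    so the two errors add up to less than \<open>e\<close>.\<close>
  define W where "W t = {f \<in> continuous_functions X. f ` L t \<subseteq> ball t (2 * e / 3)}" for t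
  have W: "openin (C_k X) (W t)" for t
    unfolding C_k_def W_def using L by (intro topology_generated_by_Basis) blast
  \<comment> \<open>The factor \<open>topspace (C_k X)\<close> covers the case of empty
    \<open>T\<close>, where the other intersection is \<open>UNIV\<close>.\<close>
  let ?V = "topspace (C_k X) \<inter> \<Inter> (W ` T)"
  have "openin (C_k X) ?V"
    using W T by (intro openin_Int_Inter openin_topspace) auto
  moreover have "y \<in> ?V"
    using y \<open>e > 0\<close> by (auto simp: W_def L_def)
  moreover have "?V \<subseteq> uniform_ball X y K e"
  proof
    fix f assume f: "f \<in> ?V"
    have "\<bar>f x - y x\<bar> < e" if x: "x \<in> K" for x
    proof -
      obtain t where t: "t \<in> T" "dist t (y x) < e / 3"
        using T x by force
      then have "x \<in> L t"
        using x K compactin_subset_topspace by (fastforce simp: L_def)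
      moreover have "f ` L t \<subseteq> ball t (2 * e / 3)"
        using f t(1) by (auto simp: W_def)
      ultimately have "dist t (f x) < 2 * e / 3"
        by (meson image_subset_iff mem_ball)
      then show ?thesis
        using t(2) unfolding dist_real_def by linarith
    qed
    then show "f \<in> uniform_ball X y K e"
      using f by (simp add: uniform_ball_def)
  qed
  ultimately show ?thesis
    by blast
qed

lemma closure_C_k_uniform_ball:
  assumes "y \<in> C_k X closure_of A" "compactin X K" "e > 0"
  shows "\<exists>f\<in>A. f \<in> uniform_ball X y K e"
proof -
  have "y \<in> continuous_functions X"
    using assms(1) by (simp add: in_closure_of)
  then show ?thesis
    using open_C_k_subset_uniform_ball[OF _ assms(2,3)] assms(1)
    unfolding in_closure_of by (metis subsetD)
qed

lemma uniform_ball_imp_open_superset: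
  assumes "f \<in> uniform_ball X y K q" "y \<in> continuous_functions X" "compactin X K"
  shows "\<exists>W. openin X W \<and> K \<subseteq> W \<and> (\<forall>x\<in>W. \<bar>f x - y x\<bar> \<le> q)"
proof -
  have "continuous_map X euclideanreal (\<lambda>x. f x - y x)"
    using assms by (intro continuous_map_diff) (auto simp: continuous_functions_def uniform_ball_def)
  then have "openin X {x \<in> topspace X. f x - y x \<in> {-q<..<q}}"
    by (rule openin_continuous_map_preimage) simp
  moreover have "K \<subseteq> {x \<in> topspace X. f x - y x \<in> {-q<..<q}}"
    using assms compactin_subset_topspace[OF assms(3)] by (force simp: uniform_ball_def abs_less_iff)
  ultimately show ?thesis
    by (intro exI[of _ "{x \<in> topspace X. f x - y x \<in> {-q<..<q}}"]) auto
qed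

section \<open>The strong Pytkeev property\<close>

lemma infinite_uniformly_close_on_nbhd:
  fixes B :: "nat \<Rightarrow> 'a set"
  assumes y: "y \<in> C_k X closure_of A" "y \<notin> A" and A: "A \<subseteq> continuous_functions X"
    and K: "compactin X K" and "q > 0"
    and B: "decseq B" "\<And>n. B n \<subseteq> topspace X"
    and base: "\<And>W. openin X W \<Longrightarrow> K \<subseteq> W \<Longrightarrow> \<exists>n. B n \<subseteq> W"
  shows "\<exists>n. infinite {f \<in> A. \<forall>x\<in>B n. \<bar>f x - y x\<bar> \<le> q}"
proof (rule ccontr)
  assume "\<not> ?thesis"
  then have fin: "finite {f \<in> A. \<forall>x\<in>B n. \<bar>f x - y x\<bar> \<le> q}" for n
    by simp
  have yC: "y \<in> continuous_functions X"
    using y by (simp add: in_closure_of)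
  define S where "S = {f \<in> A. \<exists>n. \<forall>x\<in>B n. \<bar>f x - y x\<bar> \<le> q}"
  define a where "a f = (LEAST n. \<forall>x\<in>B n. \<bar>f x - y x\<bar> \<le> q)" for f
  have a: "\<forall>x\<in>B (a f). \<bar>f x - y x\<bar> \<le> q" if f: "f \<in> S" for f
  proof -
    obtain n where "\<forall>x\<in>B n. \<bar>f x - y x\<bar> \<le> q"
      using f unfolding S_def by blast
    then show ?thesis
      unfolding a_def by (rule LeastI)
  qed
  \<comment> \<open>Since \<open>B\<close> decreases, \<open>a f \<le> n\<close> makes
    \<open>f\<close> close to \<open>y\<close> on \<open>B n\<close>, which happens for only
    finitely many \<open>f\<close>.\<close>
  have fin_a: "finite {f \<in> S. a f \<le> n}" for n
  proof (rule finite_subset[OF _ fin[of n]])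
    show "{f \<in> S. a f \<le> n} \<subseteq> {f \<in> A. \<forall>x\<in>B n. \<bar>f x - y x\<bar> \<le> q}"
      using a decseqD[OF B(1)] by (fastforce simp: S_def)
  qed
  \<comment> \<open>If \<open>a f = 0\<close>, no earlier set supplies a bad point. Then
    \<open>f \<noteq> y\<close>, a consequence of \<open>y \<notin> A\<close>, yields a point of
    \<open>topspace X\<close>, because both functions are extensional.\<close>
  have "\<exists>x\<in>topspace X. f x \<noteq> y x \<and> (a f > 0 \<longrightarrow> x \<in> B (a f - 1) \<and> \<bar>f x - y x\<bar> > q)"
    if f: "f \<in> S" for f
  proof (cases "a f = 0")
    case True
    have "f \<noteq> y" "f \<in> extensional (topspace X)" "y \<in> extensional (topspace X)"
      using f y A yC by (auto simp: S_def continuous_functions_def)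
    then obtain x where "x \<in> topspace X" "f x \<noteq> y x"
      using extensionalityI by blast
    with True show ?thesis by auto
  next
    case False
    then have "\<not> (\<forall>x\<in>B (a f - 1). \<bar>f x - y x\<bar> \<le> q)"
      unfolding a_def by (intro not_less_Least) simp
    then show ?thesis
      using B(2) \<open>q > 0\<close> by (force simp: not_le)
  qed
  then obtain x where x: "\<And>f. f \<in> S \<Longrightarrow> x f \<in> topspace X" "\<And>f. f \<in> S \<Longrightarrow> f (x f) \<noteq> y (x f)"
    "\<And>f. f \<in> S \<Longrightarrow> a f > 0 \<Longrightarrow> x f \<in> B (a f - 1) \<and> \<bar>f (x f) - y (x f)\<bar> > q"
    by metis
  have comp: "compactin X (K \<union> x ` S)"
  proof (rule compactin_Un_image_convergent[OF K])
    show "x ` S \<subseteq> topspace X"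
      using x by blast
    fix W assume "openin X W" "K \<subseteq> W"
    then obtain n where n: "B n \<subseteq> W"
      using base by blast
    have "a f \<le> n" if f: "f \<in> S" "x f \<notin> W" for f
    proof (rule ccontr)
      assume "\<not> a f \<le> n"
      then have "x f \<in> B (a f - 1)" "n \<le> a f - 1"
        using x f by auto
      then show False
        using decseqD[OF B(1)] n f by blast
    qed
    then show "finite {f \<in> S. x f \<notin> W}"
      by (intro finite_subset[OF _ fin_a[of n]]) blast
  qed
  \<comment> \<open>At \<open>x f\<close> with \<open>a f > 0\<close> the deviation exceeds
    \<open>q\<close>, so only the finitely many other \<open>f\<close> can force a smaller
    bound.\<close>
  define e where "e = Min (insert q ((\<lambda>f. \<bar>f (x f) - y (x f)\<bar>) ` {f \<in> S. a f \<le> 0}))"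
  have "e > 0"
    unfolding e_def using fin_a[of 0] \<open>q > 0\<close> x(2) by (subst Min_gr_iff) auto
  have "e \<le> q"
    unfolding e_def using fin_a[of 0] by (intro Min_le) auto
  have e: "e \<le> \<bar>f (x f) - y (x f)\<bar>" if "f \<in> S" for f
  proof (cases "a f = 0")
    case True
    then show ?thesis
      unfolding e_def using fin_a[of 0] that by (intro Min_le) auto
  next
    case False
    then show ?thesis
      using x(3)[OF that] \<open>e \<le> q\<close> by simp
  qed
  \<comment> \<open>Closeness to \<open>y\<close> on \<open>K\<close> will put \<open>f\<close> into
    \<open>S\<close>, and then closeness at \<open>x f\<close> contradicts the choice of
    \<open>e\<close>.\<close>
  obtain f where f: "f \<in> A" "f \<in> uniform_ball X y (K \<union> x ` S) e"
    using closure_C_k_uniform_ball[OF y(1) comp \<open>e > 0\<close>] by blast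
  then have "f \<in> uniform_ball X y K q"
    using \<open>e \<le> q\<close> by (force simp: uniform_ball_def)
  then obtain W where W: "openin X W" "K \<subseteq> W" "\<forall>x\<in>W. \<bar>f x - y x\<bar> \<le> q"
    using uniform_ball_imp_open_superset[OF _ yC K] by meson
  then have "f \<in> S"
    using base[OF W(1,2)] f(1) by (auto simp: S_def)
  moreover from this have "\<bar>f (x f) - y (x f)\<bar> < e"
    using f(2) by (simp add: uniform_ball_def)
  ultimately show False
    using e by fastforce
qed

lemma second_countable_imp_strong_Pytkeev_C_k:
  assumes "second_countable X"
  shows "strong_Pytkeev (C_k X)"
  unfolding strong_Pytkeev_def
proof
  fix y assume "y \<in> topspace (C_k X)"
  obtain \<G> where \<G>: "countable \<G>" "\<And>V. V \<in> \<G> \<Longrightarrow> openin X V"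
    and base: "\<And>K U. compactin X K \<Longrightarrow> openin X U \<Longrightarrow> K \<subseteq> U \<Longrightarrow> \<exists>V\<in>\<G>. K \<subseteq> V \<and> V \<subseteq> U"
    using second_countable_compact_base[OF assms] by metis
  \<comment> \<open>The family must be fixed before \<open>K\<close> is known. Finite subfamilies of
    the countable \<open>\<G>\<close> and radii \<open>1 / real (Suc n)\<close> keep it countable,
    and suitable finite intersections shrink to any given compact set.\<close>
  define N where
    "N \<F> n = {f \<in> continuous_functions X. \<forall>x\<in>\<Inter>\<F>. \<bar>f x - y x\<bar> \<le> 1 / real (Suc n)}" for \<F> n
  let ?N = "(\<lambda>(\<F>, n). N \<F> n) ` ({\<F>. finite \<F> \<and> \<F> \<subseteq> \<G>} \<times> UNIV)"
  show "\<exists>\<N>. countable \<N> \<and> \<N> \<subseteq> Pow (topspace (C_k X)) \<and>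
      (\<forall>U A. neighbourhood_in (C_k X) y U \<and> A \<subseteq> topspace (C_k X) \<and> y \<in> (C_k X closure_of A) - A
        \<longrightarrow> (\<exists>N\<in>\<N>. N \<subseteq> U \<and> infinite (N \<inter> A)))"
  proof (intro exI[of _ ?N] conjI allI impI)
    show "countable ?N"
      using \<G>(1) by (intro countable_image countable_SIGMA countable_Collect_finite_subset) auto
    show "?N \<subseteq> Pow (topspace (C_k X))"
      by (auto simp: N_def)
    fix U A
    assume asm: "neighbourhood_in (C_k X) y U \<and> A \<subseteq> topspace (C_k X) \<and> y \<in> (C_k X closure_of A) - A"
    obtain K e where K: "compactin X K" "e > 0" "uniform_ball X y K e \<subseteq> U"
      using asm uniform_ball_subset_open_C_k unfolding neighbourhood_in_def by (metis subset_trans)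
    obtain m where m: "1 / real (Suc m) < e"
      using K(2) nat_approx_posE by blast
    let ?GK = "{V \<in> \<G>. K \<subseteq> V}"
    have "?GK \<noteq> {}"
      using base[OF K(1) openin_topspace] compactin_subset_topspace[OF K(1)] by blast
    moreover have "countable ?GK"
      using \<G>(1) by simp
    ultimately obtain C :: "nat \<Rightarrow> 'a set" where C: "?GK = range C"
      using uncountable_def by metis
    have CG: "C i \<in> \<G>" "K \<subseteq> C i" for i
      using C by blast+
    \<comment> \<open>Intersecting makes the sequence decreasing; it remains a base at
      \<open>K\<close> because \<open>B n\<close> lies in \<open>C n\<close>, and each
      \<open>B n\<close> is one of the intersections used by \<open>N\<close>.\<close>
    define B where "B n = \<Inter> (C ` {..n})" for n
    have "\<exists>n. infinite {f \<in> A. \<forall>x\<in>B n. \<bar>f x - y x\<bar> \<le> 1 / real (Suc m)}"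
    proof (rule infinite_uniformly_close_on_nbhd[OF _ _ _ K(1)])
      show "decseq B"
        by (fastforce simp: decseq_def B_def)
      have "B n \<subseteq> C n" for n
        by (auto simp: B_def)
      then show "B n \<subseteq> topspace X" for n
        using openin_subset[OF \<G>(2)[OF CG(1)]] by (meson subset_trans)
      show "\<exists>n. B n \<subseteq> W" if W: "openin X W" "K \<subseteq> W" for W
      proof -
        obtain V where "V \<in> ?GK" "V \<subseteq> W"
          using base[OF K(1) W] by auto
        then obtain n where "C n \<subseteq> W"
          unfolding C by auto
        then show ?thesis
          by (intro exI[of _ n]) (auto simp: B_def)
      qed
    qed (use asm in auto)
    then obtain n where "infinite {f \<in> A. \<forall>x\<in>B n. \<bar>f x - y x\<bar> \<le> 1 / real (Suc m)}"
      by blast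
    moreover have "{f \<in> A. \<forall>x\<in>B n. \<bar>f x - y x\<bar> \<le> 1 / real (Suc m)} = N (C ` {..n}) m \<inter> A"
      using asm by (auto simp: N_def B_def)
    ultimately have "infinite (N (C ` {..n}) m \<inter> A)"
      by simp
    moreover have "N (C ` {..n}) m \<subseteq> uniform_ball X y K e"
    proof
      fix f assume f: "f \<in> N (C ` {..n}) m"
      have "\<bar>f x - y x\<bar> < e" if "x \<in> K" for x
      proof -
        have "x \<in> \<Inter> (C ` {..n})"
          using CG(2) that by blast
        then have "\<bar>f x - y x\<bar> \<le> 1 / real (Suc m)"
          using f unfolding N_def by blast
        then show ?thesis
          using m by simp
      qed
      then show "f \<in> uniform_ball X y K e"
        using f by (simp add: N_def uniform_ball_def)
    qed
    moreover have "N (C ` {..n}) m \<in> ?N"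
      using CG(1) by (intro image_eqI[of _ _ "(C ` {..n}, m)"]) auto
    ultimately show "\<exists>N\<in>?N. N \<subseteq> U \<and> infinite (N \<inter> A)"
      using K(3) by (meson subset_trans)
  qed
qed

theorem corollary8:
  fixes X :: "'a topology"
  assumes "polish_topology X"
  shows "strong_Pytkeev (C_k X)"
  using assms completely_metrizable_imp_metrizable_space metrizable_separable_imp_second_countable
    second_countable_imp_strong_Pytkeev_C_k
  unfolding polish_topology_def by blast

end
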